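(* Let $\{\theta_n\}_{n\ge 0}$ be the sequence generated by the stochastic algorithm $\theta_{n+1}=\theta_n+\alpha F_n$ with deterministic $\theta_0\in\Theta$, and let $\varphi:\mathbb{R}_{\ge 0}\times\Theta\to\Theta$ be the flow of the mean ODE, i.e. for each $\theta\in\Theta$, $\varphi(\cdot;\theta)$ is absolutely continuous and $\varphi(t;\theta)=\theta+\int_0^t F(\varphi(\tau;\theta))\,\mathrm{d}\tau$ for all $t\ge 0$. Suppose that there is a function $\Psi:\Theta\to\mathbb{R}_{\ge 0}$ satisfying the following two conditions. (A1) There exists a nonincreasing $\Delta_{1}:\mathbb{R}_{\ge 0}\to\mathbb{R}_{\ge 0}$ such that $\Delta_1(t)\downarrow 0$ as $t\uparrow\infty$, and for any $\theta\in\Theta$ and any $t\in\mathbb{R}_{\ge 0}$, $$\Psi(\varphi(t;\theta))\le \Delta_1(t)\,\Psi(\theta).$$ (A2) There exists $\Delta_2:\mathbb{R}_+\times\mathbb{R}_+\to\mathbb{R}_+$, nondecreasing with respect to each argument, such that $\Delta_2(\alpha,T)\downarrow 0$ as $\alpha\downarrow 0$ for any fixed $T$, and for any step-size $\alpha$, any $N\in\mathbb{N}_+$ and any $\theta_0\in\Theta$, $$\mathbb{E}_0[\Psi(\theta_N)]\le \Psi(\varphi(N\alpha;\theta_0))+\Delta_2(\alpha,N\alpha)\,\Psi(\theta_0).$$ Then there exists $\bar\alpha>0$ such that, for any $\alpha\in(0,\bar\alpha]$, there exist $\gamma_\alpha\in(0,1)$ and $C_\alpha>0$ such that for all $\theta_0\in\Theta$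 and all $n\in\mathbb{N}_+$, $$\mathbb{E}[\Psi(\theta_n)]\le \gamma_\alpha^{\,n}\,C_\alpha\,\Psi(\theta_0).$$ Moreover, $$\limsup_{n\to\infty}\frac1n\ln\mathbb{E}[\Psi(\theta_n)]\le\ln\gamma_\alpha .$$
   Context: Notation: $\mathbb{N}$ and $\mathbb{N}_+$ are the nonnegative and the positive integers; $\mathbb{R}_{\ge0}=[0,\infty)$, $\mathbb{R}_+=(0,\infty)$; $\ln 0=-\infty$. Setting: $\Theta\subseteq\mathbb{R}^{D}$ for a positive integer $D$. The stochastic algorithm with constant step-size $\alpha>0$ is $\theta_{n+1}=\theta_n+\alpha F_n$, where the $F_n$ are random vectors in $\mathbb{R}^{D}$. Let $\{\mathcal{F}_n\}$ be the natural filtration associated with $\{\theta_n\}$. The dependency of $F_n$ on the past is only through $\theta_n$, and the conditional distribution of $F_n$ given $\theta_n=\theta$ does not depend on $n$ (time-homogeneity). The mean field $F(\theta)=\mathbb{E}[F_n\mid\theta_n=\theta]$ is assumed to be well defined. The associated mean ODE is $\mathrm{d}\theta/\mathrm{d}t=F(\theta)$. $\mathbb{E}_n=\mathbb{E}[\cdot\mid\mathcal{F}_n]$; in particular $\mathbb{E}_0$ is the conditional expectation given $\theta_0$. Standing assumption: for all sufficiently small $\alpha$, $\{\theta_n\}$ never leaves $\Theta$; step-sizes are understood to be in this range. *)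

theory Defs
  imports "HOL-Probability.Probability"
begin

text \<open>Absolute continuity of a function of one real variable on an interval \<open>I\<close>; the library
  only has absolute continuity of measures.\<close>

definition abs_continuous_on :: "real set \<Rightarrow> (real \<Rightarrow> 'b::real_normed_vector) \<Rightarrow> bool" where
  "abs_continuous_on I f \<longleftrightarrow>
    (\<forall>\<epsilon>>0. \<exists>\<delta>>0. \<forall>S :: (real \<times> real) set.
      finite S \<and> (\<forall>(u, v)\<in>S. u < v \<and> {u..v} \<subseteq> I) \<and>
      pairwise (\<lambda>(u, v) (u', v'). {u<..<v} \<inter> {u'<..<v'} = {}) S \<and>
      (\<Sum>(u, v)\<in>S. v - u) < \<delta>
      \<longrightarrow> (\<Sum>(u, v)\<in>S. norm (f v - f u)) < \<epsilon>)"

text \<open>\<open>ode_flow \<Theta> F \<phi>\<close>: \<open>\<phi>\<close> is the flow on \<open>\<Theta>\<close> of \<open>d\<theta>/dt = F(\<theta>)\<close>. On the unbounded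
  interval \<open>[0, \<infinity>)\<close> absolute continuity is required on each compact \<open>[0, T]\<close>.
  The integral is a Lebesgue integral, whose existence is part of the condition.\<close>

definition ode_flow ::
  "(real ^ 'd) set \<Rightarrow> (real ^ 'd \<Rightarrow> real ^ 'd) \<Rightarrow> (real \<Rightarrow> real ^ 'd \<Rightarrow> real ^ 'd) \<Rightarrow> bool" where
  "ode_flow \<Theta> F \<phi> \<longleftrightarrow>
    (\<forall>x\<in>\<Theta>.
      (\<forall>t\<ge>0. \<phi> t x \<in> \<Theta>) \<and>
      (\<forall>T\<ge>0. abs_continuous_on {0..T} (\<lambda>t. \<phi> t x)) \<and>
      (\<forall>t\<ge>0. (\<lambda>\<tau>. F (\<phi> \<tau> x)) absolutely_integrable_on {0..t} \<and>
              \<phi> t x = x + integral {0..t} (\<lambda>\<tau>. F (\<phi> \<tau> x))))"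

definition natural_filtration ::
  "'w measure \<Rightarrow> (nat \<Rightarrow> 'w \<Rightarrow> 'b::topological_space) \<Rightarrow> nat \<Rightarrow> 'w measure" where
  "natural_filtration M X n =
    sigma (space M) {X i -` A \<inter> space M | i A. i \<le> n \<and> A \<in> sets borel}"

text \<open>\<open>K x\<close> is the conditional distribution of the increment \<open>F\<^sub>n\<close> given \<open>\<theta>\<^sub>n = x\<close>.
  The last clause says that the conditional law of \<open>F\<^sub>n\<close> given the whole past
  \<open>\<theta>\<^sub>0, \<dots>, \<theta>\<^sub>n\<close> is \<open>K \<theta>\<^sub>n\<close>, with the same \<open>K\<close> for every \<open>n\<close>.\<close>

definition stochastic_algorithm ::
  "'w measure \<Rightarrow> (real ^ 'd) set \<Rightarrow> (real ^ 'd \<Rightarrow> (real ^ 'd) measure) \<Rightarrow> real \<Rightarrow> real ^ 'd \<Rightarrow>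
   (nat \<Rightarrow> 'w \<Rightarrow> real ^ 'd) \<Rightarrow> (nat \<Rightarrow> 'w \<Rightarrow> real ^ 'd) \<Rightarrow> bool" where
  "stochastic_algorithm M \<Theta> K \<alpha> x \<theta> Fn \<longleftrightarrow>
    prob_space M \<and>
    (\<forall>n. \<theta> n \<in> borel_measurable M) \<and>
    (\<forall>n. Fn n \<in> borel_measurable M) \<and>
    (\<forall>\<omega>\<in>space M. \<theta> 0 \<omega> = x) \<and>
    (\<forall>n. \<forall>\<omega>\<in>space M. \<theta> (Suc n) \<omega> = \<theta> n \<omega> + \<alpha> *\<^sub>R Fn n \<omega>) \<and>
    (\<forall>n. \<forall>\<omega>\<in>space M. \<theta> n \<omega> \<in> \<Theta>) \<and>
    (\<forall>n. \<forall>A\<in>sets borel. AE \<omega> in M.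
      real_cond_exp M (natural_filtration M \<theta> n) (\<lambda>\<omega>. indicator A (Fn n \<omega>)) \<omega>
        = measure (K (\<theta> n \<omega>)) A)"

definition ln_ext :: "ennreal \<Rightarrow> ereal" where
  "ln_ext x = (if x = 0 then - \<infinity> else if x = \<infinity> then \<infinity> else ereal (ln (enn2real x)))"

end

theory Submission
  imports Defs
begin

text \<open>Fix a time \<open>T\<close> after which the flow has shrunk \<open>\<Psi>\<close> by a factor \<open>1/4\<close>; this choice does not
  depend on the starting point. For a small step-size \<open>\<alpha> \<le> 1\<close>, take the least number \<open>N\<close> of
  steps that covers the time \<open>T\<close>. The elapsed time \<open>N\<alpha>\<close> then lies in \<open>[T, T + 1]\<close>, so
  monotonicity bounds the discretization error by \<open>\<Delta>\<^sub>2 \<alpha> (T + 1)\<close>, which is below \<open>1/4\<close> once \<open>\<alpha>\<close> is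
  small. One block of \<open>N\<close> steps therefore halves the expected value of \<open>\<Psi>\<close>, from every starting
  point.

  To iterate this, the block estimate has to be applied from the random state \<open>\<theta>\<^sub>m\<close>. This is
  the Markov property \<open>expect_add\<close>: the chain started at \<open>x\<close> and run for \<open>m + n\<close> steps has
  the same law as a fresh chain run for \<open>n\<close> steps from the state reached after \<open>m\<close> steps.
  The chains for different starting points may live on unrelated probability spaces; what links
  them is that all of them draw their increments from the same kernel.

  Halving on every block gives \<open>E \<Psi>(\<theta>\<^sub>n) \<le> \<gamma>^n C \<Psi>(x)\<close> with \<open>\<gamma>\<close> the \<open>N\<close>-th root of \<open>1/2\<close>; the
  incomplete block at the start only costs a constant
  (\<open>geometric_decay_of_block_contraction\<close>). Taking logarithms makes the constant disappear in
  the limit (\<open>limsup_growth_rate_le\<close>).\<close>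

section \<open>Conditioning on the natural filtration\<close>

lemma subalgebra_natural_filtration:
  assumes "\<And>i. X i \<in> borel_measurable M"
  shows "subalgebra M (natural_filtration M X n)"
proof -
  have gen: "{X i -` A \<inter> space M | i A. i \<le> n \<and> A \<in> sets borel} \<subseteq> sets M"
    using assms by (auto intro: measurable_sets)
  then have "sigma_sets (space M) {X i -` A \<inter> space M | i A. i \<le> n \<and> A \<in> sets borel} \<subseteq> sets M"
    by (rule sets.sigma_sets_subset)
  then show ?thesis
    using gen sets.space_closed[of M]
    by (auto simp: subalgebra_def natural_filtration_def sets_measure_of_conv space_measure_of_conv)
qed

lemma vimage_in_natural_filtration:
  assumes "A \<in> sets borel"
  shows "X n -` A \<inter> space M \<in> sets (natural_filtration M X n)"
proof -
  let ?G = "{X i -` A \<inter> space M | i A. i \<le> n \<and> A \<in> sets borel}"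
  have "?G \<subseteq> Pow (space M)"
    by auto
  moreover have "X n -` A \<inter> space M \<in> ?G"
    using assms by blast
  ultimately show ?thesis
    unfolding natural_filtration_def by (simp add: in_measure_of)
qed

lemma (in prob_space) sigma_finite_subalgebra_natural_filtration:
  assumes "\<And>i. X i \<in> borel_measurable M"
  shows "sigma_finite_subalgebra M (natural_filtration M X n)"
  by (intro finite_measure_subalgebra_is_sigma_finite finite_measure_subalgebra.intro
      finite_measure_axioms finite_measure_subalgebra_axioms.intro
      subalgebra_natural_filtration assms)

lemma (in sigma_finite_subalgebra) nn_integral_nn_cond_exp:
  assumes "f \<in> borel_measurable M"
  shows "(\<integral>\<^sup>+\<omega>. nn_cond_exp M F f \<omega> \<partial>M) = (\<integral>\<^sup>+\<omega>. f \<omega> \<partial>M)"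
  using nn_cond_exp_intg[of "\<lambda>_. 1" f] assms by simp

section \<open>The Markov property\<close>

text \<open>The algorithm at one fixed step-size, run from every point of \<open>\<Theta>\<close>. The state
  space is \<open>\<Theta>\<close> with the trace of the Borel sets, which makes sense for an arbitrary set \<open>\<Theta>\<close>.\<close>

locale markov_algorithm =
  fixes \<Theta> :: "(real ^ 'd) set"
    and K :: "real ^ 'd \<Rightarrow> (real ^ 'd) measure"
    and \<alpha> :: real
    and M :: "real ^ 'd \<Rightarrow> 'w measure"
    and \<theta> Fn :: "real ^ 'd \<Rightarrow> nat \<Rightarrow> 'w \<Rightarrow> real ^ 'd"
  assumes kernel: "K \<in> restrict_space borel \<Theta> \<rightarrow>\<^sub>M prob_algebra borel"
    and algorithm: "x \<in> \<Theta> \<Longrightarrow> stochastic_algorithm (M x) \<Theta> K \<alpha> x (\<theta> x) (Fn x)"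
begin

lemma prob_space_M: "x \<in> \<Theta> \<Longrightarrow> prob_space (M x)"
  and measurable_Fn: "x \<in> \<Theta> \<Longrightarrow> Fn x n \<in> borel_measurable (M x)"
  and start: "x \<in> \<Theta> \<Longrightarrow> \<omega> \<in> space (M x) \<Longrightarrow> \<theta> x 0 \<omega> = x"
  and step: "x \<in> \<Theta> \<Longrightarrow> \<omega> \<in> space (M x) \<Longrightarrow> \<theta> x (Suc n) \<omega> = \<theta> x n \<omega> + \<alpha> *\<^sub>R Fn x n \<omega>"
  and in_domain: "x \<in> \<Theta> \<Longrightarrow> \<omega> \<in> space (M x) \<Longrightarrow> \<theta> x n \<omega> \<in> \<Theta>"
  and measurable_\<theta>_borel: "x \<in> \<Theta> \<Longrightarrow> \<theta> x n \<in> borel_measurable (M x)"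
  using algorithm[of x] by (auto simp: stochastic_algorithm_def)

lemma measurable_\<theta>: "x \<in> \<Theta> \<Longrightarrow> \<theta> x n \<in> M x \<rightarrow>\<^sub>M restrict_space borel \<Theta>"
  using measurable_\<theta>_borel in_domain by (auto intro!: measurable_restrict_space2)

lemma space_kernel_domain: "space (restrict_space borel \<Theta>) = \<Theta>"
  by (simp add: space_restrict_space)

lemma prob_space_K: "x \<in> \<Theta> \<Longrightarrow> prob_space (K x)"
  and sets_K: "x \<in> \<Theta> \<Longrightarrow> sets (K x) = sets borel"
  using measurable_space[OF kernel, of x] by (auto simp: space_kernel_domain space_prob_algebra)

text \<open>The event \<open>\<theta>\<^sub>n \<in> B\<close> belongs to the past, so integrating the conditional law of the increment
  over it yields the joint law on rectangles.\<close>

lemma prob_state_and_increment: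
  assumes x: "x \<in> \<Theta>" and B: "B \<in> sets borel" and A: "A \<in> sets borel"
  shows "emeasure (M x) {\<omega> \<in> space (M x). \<theta> x n \<omega> \<in> B \<and> Fn x n \<omega> \<in> A}
    = (\<integral>\<^sup>+\<omega>. indicator B (\<theta> x n \<omega>) * emeasure (K (\<theta> x n \<omega>)) A \<partial>M x)"
proof -
  interpret prob_space "M x" by (rule prob_space_M[OF x])
  let ?G = "natural_filtration (M x) (\<theta> x) n"
  interpret S: sigma_finite_subalgebra "M x" ?G
    by (rule sigma_finite_subalgebra_natural_filtration) (rule measurable_\<theta>_borel[OF x])
  note [measurable] = measurable_\<theta>_borel[OF x] measurable_Fn[OF x] A B
  let ?V = "\<theta> x n -` B \<inter> space (M x)"
  have V: "?V \<in> sets ?G" by (rule vimage_in_natural_filtration[OF B])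
  have VM [measurable]: "?V \<in> sets (M x)" by measurable
  have [measurable]: "(\<lambda>\<omega>. measure (K (\<theta> x n \<omega>)) A) \<in> borel_measurable (M x)"
    by (intro measurable_compose[OF measurable_\<theta>[OF x]] measurable_compose[OF kernel]
        measurable_measure_prob_algebra A)
  have le1: "measure (K (\<theta> x n \<omega>)) A \<le> 1" if "\<omega> \<in> space (M x)" for \<omega>
    using prob_space.prob_le_1[OF prob_space_K[OF in_domain[OF x that]]] .
  have int: "integrable (M x) (\<lambda>\<omega>. indicat_real A (Fn x n \<omega>))"
    by (rule integrable_const_bound[where B=1]) (auto simp: indicator_def)
  have ce: "AE \<omega> in M x. real_cond_exp (M x) ?G (\<lambda>\<omega>. indicator A (Fn x n \<omega>)) \<omega>
      = measure (K (\<theta> x n \<omega>)) A"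
    using algorithm[OF x] A by (auto simp: stochastic_algorithm_def)
  have "measure (M x) {\<omega> \<in> space (M x). \<theta> x n \<omega> \<in> B \<and> Fn x n \<omega> \<in> A}
      = (\<integral>\<omega>. indicator {\<omega> \<in> space (M x). \<theta> x n \<omega> \<in> B \<and> Fn x n \<omega> \<in> A} \<omega> \<partial>M x)"
    by simp
  also have "\<dots> = (\<integral>\<omega>\<in>?V. indicat_real A (Fn x n \<omega>) \<partial>M x)"
    unfolding set_lebesgue_integral_def
    by (intro Bochner_Integration.integral_cong) (auto simp: indicator_def)
  also have "\<dots> = (\<integral>\<omega>\<in>?V. real_cond_exp (M x) ?G (\<lambda>\<omega>. indicator A (Fn x n \<omega>)) \<omega> \<partial>M x)"
    by (rule S.real_cond_exp_intA[OF int V])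
  also have "\<dots> = (\<integral>\<omega>\<in>?V. measure (K (\<theta> x n \<omega>)) A \<partial>M x)"
    unfolding set_lebesgue_integral_def using ce
    by (intro integral_cong_AE) (auto intro: measurable_from_subalg[OF S.subalg])
  finally have "measure (M x) {\<omega> \<in> space (M x). \<theta> x n \<omega> \<in> B \<and> Fn x n \<omega> \<in> A}
      = (\<integral>\<omega>. indicator ?V \<omega> * measure (K (\<theta> x n \<omega>)) A \<partial>M x)"
    by (simp add: set_lebesgue_integral_def)
  moreover have "ennreal (\<integral>\<omega>. indicator ?V \<omega> * measure (K (\<theta> x n \<omega>)) A \<partial>M x)
      = (\<integral>\<^sup>+\<omega>. ennreal (indicator ?V \<omega> * measure (K (\<theta> x n \<omega>)) A) \<partial>M x)"
    using le1
    by (intro nn_integral_eq_integral[symmetric] integrable_const_bound[where B=1])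
       (auto simp: indicator_def intro!: AE_I2)
  moreover have "\<dots> = (\<integral>\<^sup>+\<omega>. indicator B (\<theta> x n \<omega>) * emeasure (K (\<theta> x n \<omega>)) A \<partial>M x)"
  proof (intro nn_integral_cong)
    fix \<omega> assume \<omega>: "\<omega> \<in> space (M x)"
    interpret K: prob_space "K (\<theta> x n \<omega>)"
      by (rule prob_space_K[OF in_domain[OF x \<omega>]])
    show "ennreal (indicator ?V \<omega> * measure (K (\<theta> x n \<omega>)) A)
        = indicator B (\<theta> x n \<omega>) * emeasure (K (\<theta> x n \<omega>)) A"
      using \<omega> by (auto simp: K.emeasure_eq_measure indicator_def)
  qed
  ultimately show ?thesis
    by (simp add: emeasure_eq_measure)
qed

text \<open>Rectangles form an intersection-stable generator of the product, so the formula on rectangles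
  identifies the law of the pair with the mixture of the kernels. The general set \<open>S\<close> is needed
  because the next state depends on state and increment together.\<close>

lemma joint_law:
  assumes x: "x \<in> \<Theta>" and S: "S \<in> sets (restrict_space borel \<Theta> \<Otimes>\<^sub>M borel)"
  shows "emeasure (M x) {\<omega> \<in> space (M x). (\<theta> x n \<omega>, Fn x n \<omega>) \<in> S}
    = (\<integral>\<^sup>+\<omega>. emeasure (K (\<theta> x n \<omega>)) {z. (\<theta> x n \<omega>, z) \<in> S} \<partial>M x)"
proof -
  interpret prob_space "M x" by (rule prob_space_M[OF x])
  let ?R = "restrict_space borel \<Theta>"
  let ?P = "?R \<Otimes>\<^sub>M (borel :: (real ^ 'd) measure)"
  let ?J = "\<lambda>\<omega>. (\<theta> x n \<omega>, Fn x n \<omega>)"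
  let ?k = "\<lambda>\<omega>. distr (K (\<theta> x n \<omega>)) ?P (Pair (\<theta> x n \<omega>))"
  note [measurable] = measurable_\<theta>[OF x] measurable_Fn[OF x]
  have Kn: "(\<lambda>\<omega>. K (\<theta> x n \<omega>)) \<in> M x \<rightarrow>\<^sub>M subprob_algebra borel"
    by (intro measurable_prob_algebraD measurable_compose[OF measurable_\<theta>[OF x] kernel])
  have k: "?k \<in> M x \<rightarrow>\<^sub>M subprob_algebra ?P"
    by (rule measurable_distr2[OF _ Kn]) measurable
  have J: "?J \<in> M x \<rightarrow>\<^sub>M ?P" by measurable
  have em_k: "emeasure (?k \<omega>) X = emeasure (K (\<theta> x n \<omega>)) {z. (\<theta> x n \<omega>, z) \<in> X}"
    if X: "X \<in> sets ?P" and \<omega>: "\<omega> \<in> space (M x)" for X \<omega>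
  proof -
    have "Pair (\<theta> x n \<omega>) \<in> K (\<theta> x n \<omega>) \<rightarrow>\<^sub>M ?P"
      using in_domain[OF x \<omega>]
      by (subst measurable_cong_sets[OF sets_K refl]) (auto simp: space_kernel_domain)
    moreover have "space (K (\<theta> x n \<omega>)) = UNIV"
      using sets_eq_imp_space_eq[OF sets_K[OF in_domain[OF x \<omega>]]] by simp
    ultimately show ?thesis
      using X by (simp add: emeasure_distr vimage_def)
  qed
  have em_bind: "emeasure (M x \<bind> ?k) X
      = (\<integral>\<^sup>+\<omega>. emeasure (K (\<theta> x n \<omega>)) {z. (\<theta> x n \<omega>, z) \<in> X} \<partial>M x)"
    if X: "X \<in> sets ?P" for X
    by (subst emeasure_bind[OF not_empty k X]) (intro nn_integral_cong em_k X)
  have em_distr: "emeasure (distr (M x) ?P ?J) X = emeasure (M x) {\<omega> \<in> space (M x). ?J \<omega> \<in> X}"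
    if X: "X \<in> sets ?P" for X
    using J X by (simp add: emeasure_distr vimage_def Int_def conj_commute)
  have "distr (M x) ?P ?J = M x \<bind> ?k"
  proof (rule measure_eqI_generator_eq[OF Int_stable_pair_measure_generator[of ?R borel]])
    let ?E = "{a \<times> b | a b. a \<in> sets ?R \<and> b \<in> sets (borel :: (real ^ 'd) measure)}"
    show "?E \<subseteq> Pow (space ?R \<times> space borel)"
      by (rule pair_measure_closed)
    show "sets (distr (M x) ?P ?J) = sigma_sets (space ?R \<times> space borel) ?E"
      by (simp add: sets_pair_measure)
    show "sets (M x \<bind> ?k) = sigma_sets (space ?R \<times> space borel) ?E"
      using sets_bind[OF _ not_empty, of ?k ?P] by (simp add: sets_pair_measure)
    show "range (\<lambda>_::nat. space ?R \<times> space borel) \<subseteq> ?E"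
      by (blast intro: sets.top)
    show "(\<Union>i::nat. space ?R \<times> space borel) = space ?R \<times> space borel" by simp
    show "emeasure (distr (M x) ?P ?J) (space ?R \<times> space borel) \<noteq> \<infinity>" for i :: nat
      by (subst em_distr) (auto simp: emeasure_eq_measure)
    fix X assume "X \<in> ?E"
    then obtain B A where B: "B \<in> sets borel" and A: "A \<in> sets borel" and X: "X = (\<Theta> \<inter> B) \<times> A"
      by (auto simp: sets_restrict_space)
    have XP: "X \<in> sets ?P" using A B by (auto simp: X sets_restrict_space)
    have "{\<omega> \<in> space (M x). ?J \<omega> \<in> X} = {\<omega> \<in> space (M x). \<theta> x n \<omega> \<in> B \<and> Fn x n \<omega> \<in> A}"
      using in_domain[OF x] by (auto simp: X)
    moreover have "(\<integral>\<^sup>+\<omega>. emeasure (K (\<theta> x n \<omega>)) {z. (\<theta> x n \<omega>, z) \<in> X} \<partial>M x)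
        = (\<integral>\<^sup>+\<omega>. indicator B (\<theta> x n \<omega>) * emeasure (K (\<theta> x n \<omega>)) A \<partial>M x)"
      using in_domain[OF x] by (intro nn_integral_cong) (auto simp: X indicator_def)
    ultimately show "emeasure (distr (M x) ?P ?J) X = emeasure (M x \<bind> ?k) X"
      by (simp only: em_distr[OF XP] em_bind[OF XP] prob_state_and_increment[OF x B A])
  qed
  then show ?thesis
    by (simp only: em_distr[OF S, symmetric] em_bind[OF S, symmetric])
qed

lemma prob_next_state:
  assumes x: "x \<in> \<Theta>" and A: "A \<in> sets borel"
  shows "emeasure (M x) {\<omega> \<in> space (M x). \<theta> x (Suc n) \<omega> \<in> A}
    = (\<integral>\<^sup>+\<omega>. emeasure (K (\<theta> x n \<omega>)) {z. \<theta> x n \<omega> + \<alpha> *\<^sub>R z \<in> A} \<partial>M x)"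
proof -
  let ?P = "restrict_space borel \<Theta> \<Otimes>\<^sub>M (borel :: (real ^ 'd) measure)"
  let ?S = "{p \<in> space ?P. fst p + \<alpha> *\<^sub>R snd p \<in> A}"
  have [measurable]: "(\<lambda>y. y) \<in> restrict_space borel \<Theta> \<rightarrow>\<^sub>M borel"
    by (rule measurable_restrict_space1) simp
  have [measurable]: "fst \<in> ?P \<rightarrow>\<^sub>M borel"
    by (rule measurable_compose[OF measurable_fst]) simp
  have S: "?S \<in> sets ?P" using A by measurable
  have "{\<omega> \<in> space (M x). \<theta> x (Suc n) \<omega> \<in> A}
      = {\<omega> \<in> space (M x). (\<theta> x n \<omega>, Fn x n \<omega>) \<in> ?S}"
    using in_domain[OF x] step[OF x] by (auto simp: space_pair_measure space_kernel_domain)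
  moreover have "(\<integral>\<^sup>+\<omega>. emeasure (K (\<theta> x n \<omega>)) {z. (\<theta> x n \<omega>, z) \<in> ?S} \<partial>M x)
      = (\<integral>\<^sup>+\<omega>. emeasure (K (\<theta> x n \<omega>)) {z. \<theta> x n \<omega> + \<alpha> *\<^sub>R z \<in> A} \<partial>M x)"
    using in_domain[OF x]
    by (intro nn_integral_cong) (auto simp: space_pair_measure space_kernel_domain)
  ultimately show ?thesis using joint_law[OF x S, of n] by simp
qed

text \<open>The one-step kernel is read off the first step of the chain started at \<open>y\<close>, as a measure on the
  trace \<open>\<sigma>\<close>-algebra. The push-forward of \<open>K y\<close> under \<open>z \<mapsto> y + \<alpha> z\<close> would live on all of the
  Euclidean space instead, and could not be restricted to a set \<open>\<Theta>\<close> that is not measurable.\<close>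

definition transition :: "real ^ 'd \<Rightarrow> (real ^ 'd) measure" where
  "transition y = distr (M y) (restrict_space borel \<Theta>) (\<theta> y 1)"

text \<open>The state before the first step is the deterministic \<open>y\<close>, which removes the outer integral.
  The right-hand side no longer mentions the probability space of the chain, which is why the
  transition kernel is measurable in \<open>y\<close> and also governs the steps of chains started elsewhere.\<close>

lemma emeasure_transition:
  assumes y: "y \<in> \<Theta>" and A: "A \<in> sets borel"
  shows "emeasure (transition y) (\<Theta> \<inter> A) = emeasure (K y) {z. y + \<alpha> *\<^sub>R z \<in> A}"
proof -
  interpret prob_space "M y" by (rule prob_space_M[OF y])
  have "emeasure (transition y) (\<Theta> \<inter> A) = emeasure (M y) {\<omega> \<in> space (M y). \<theta> y (Suc 0) \<omega> \<in> A}"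
    using A in_domain[OF y] measurable_\<theta>[OF y]
    by (auto simp: transition_def emeasure_distr sets_restrict_space intro!: arg_cong2[where f=emeasure])
  also have "\<dots> = (\<integral>\<^sup>+\<omega>. emeasure (K y) {z. y + \<alpha> *\<^sub>R z \<in> A} \<partial>M y)"
    by (subst prob_next_state[OF y A]) (intro nn_integral_cong, simp add: start[OF y])
  finally show ?thesis by (simp add: emeasure_space_1)
qed

lemma measurable_transition:
  "transition \<in> restrict_space borel \<Theta> \<rightarrow>\<^sub>M subprob_algebra (restrict_space borel \<Theta>)"
proof (rule measurable_subprob_algebra)
  let ?R = "restrict_space borel \<Theta>"
  fix y assume "y \<in> space ?R"
  then have y: "y \<in> \<Theta>" by (simp add: space_kernel_domain)
  show "subprob_space (transition y)"
    unfolding transition_def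
    by (intro prob_space_imp_subprob_space prob_space.prob_space_distr prob_space_M measurable_\<theta> y)
  show "sets (transition y) = sets ?R" by (simp add: transition_def)
next
  let ?R = "restrict_space borel \<Theta>"
  fix X assume "X \<in> sets ?R"
  then obtain A where A [measurable]: "A \<in> sets borel" and X: "X = \<Theta> \<inter> A"
    by (auto simp: sets_restrict_space)
  have [measurable]: "(\<lambda>y. y) \<in> ?R \<rightarrow>\<^sub>M borel"
    by (rule measurable_restrict_space1) simp
  have [measurable]: "fst \<in> ?R \<Otimes>\<^sub>M (borel :: (real ^ 'd) measure) \<rightarrow>\<^sub>M borel"
    by (rule measurable_compose[OF measurable_fst]) simp
  have "(SIGMA y:space ?R. {z. y + \<alpha> *\<^sub>R z \<in> A})
      = {p \<in> space (?R \<Otimes>\<^sub>M borel). fst p + \<alpha> *\<^sub>R snd p \<in> A}"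
    by (auto simp: space_pair_measure)
  also have "\<dots> \<in> sets (?R \<Otimes>\<^sub>M borel)" by measurable
  finally have "(\<lambda>y. emeasure (K y) {z. y + \<alpha> *\<^sub>R z \<in> A}) \<in> borel_measurable ?R"
    by (rule emeasure_measurable_subprob_algebra2) (rule measurable_prob_algebraD[OF kernel])
  then show "(\<lambda>y. emeasure (transition y) X) \<in> borel_measurable ?R"
    by (subst measurable_cong[OF emeasure_transition[OF _ A, folded X]])
       (auto simp: space_kernel_domain)
qed

text \<open>The Markov semigroup of the algorithm acting on functions of the state.\<close>

definition expect :: "nat \<Rightarrow> (real ^ 'd \<Rightarrow> ennreal) \<Rightarrow> real ^ 'd \<Rightarrow> ennreal" where
  "expect n g x = (\<integral>\<^sup>+\<omega>. g (\<theta> x n \<omega>) \<partial>M x)"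

lemma expect_1:
  assumes "y \<in> \<Theta>" "g \<in> borel_measurable (restrict_space borel \<Theta>)"
  shows "expect 1 g y = (\<integral>\<^sup>+z. g z \<partial>transition y)"
  using assms measurable_\<theta> by (simp add: expect_def transition_def nn_integral_distr)

lemma expect_0:
  assumes y: "y \<in> \<Theta>"
  shows "expect 0 g y = g y"
proof -
  have "expect 0 g y = (\<integral>\<^sup>+\<omega>. g y \<partial>M y)"
    unfolding expect_def by (intro nn_integral_cong) (simp add: start[OF y])
  then show ?thesis by (simp add: prob_space.emeasure_space_1[OF prob_space_M[OF y]])
qed

lemma expect_mono:
  assumes "x \<in> \<Theta>" "\<And>y. y \<in> \<Theta> \<Longrightarrow> f y \<le> g y"
  shows "expect n f x \<le> expect n g x"
  unfolding expect_def using assms in_domain by (intro nn_integral_mono) auto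

lemma expect_cong:
  assumes "x \<in> \<Theta>" "\<And>y. y \<in> \<Theta> \<Longrightarrow> f y = g y"
  shows "expect n f x = expect n g x"
  unfolding expect_def using assms in_domain by (intro nn_integral_cong) auto

text \<open>The law of \<open>\<theta>\<^sub>n\<^sub>+\<^sub>1\<close> is that of \<open>\<theta>\<^sub>n\<close> followed by the transition kernel, since the two agree
  on traces of Borel sets.\<close>

lemma expect_Suc:
  assumes x: "x \<in> \<Theta>" and g: "g \<in> borel_measurable (restrict_space borel \<Theta>)"
  shows "expect (Suc n) g x = expect n (expect 1 g) x"
proof -
  interpret prob_space "M x" by (rule prob_space_M[OF x])
  let ?R = "restrict_space borel \<Theta>"
  have t: "(\<lambda>\<omega>. transition (\<theta> x n \<omega>)) \<in> M x \<rightarrow>\<^sub>M subprob_algebra ?R"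
    by (rule measurable_compose[OF measurable_\<theta>[OF x] measurable_transition])
  have "distr (M x) ?R (\<theta> x (Suc n)) = M x \<bind> (\<lambda>\<omega>. transition (\<theta> x n \<omega>))"
  proof (rule measure_eqI)
    show "sets (distr (M x) ?R (\<theta> x (Suc n))) = sets (M x \<bind> (\<lambda>\<omega>. transition (\<theta> x n \<omega>)))"
      by (subst sets_bind[OF _ not_empty]) (auto simp: transition_def)
    fix X assume "X \<in> sets (distr (M x) ?R (\<theta> x (Suc n)))"
    then obtain A where A: "A \<in> sets borel" and X: "X = \<Theta> \<inter> A" and XR: "X \<in> sets ?R"
      by (auto simp: sets_restrict_space)
    have "emeasure (distr (M x) ?R (\<theta> x (Suc n))) X
        = emeasure (M x) {\<omega> \<in> space (M x). \<theta> x (Suc n) \<omega> \<in> A}"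
      using XR in_domain[OF x] measurable_\<theta>[OF x]
      by (auto simp: emeasure_distr X intro!: arg_cong2[where f=emeasure])
    also have "\<dots> = (\<integral>\<^sup>+\<omega>. emeasure (transition (\<theta> x n \<omega>)) X \<partial>M x)"
      unfolding prob_next_state[OF x A] X
      by (intro nn_integral_cong emeasure_transition[OF _ A, symmetric] in_domain[OF x])
    also have "\<dots> = emeasure (M x \<bind> (\<lambda>\<omega>. transition (\<theta> x n \<omega>))) X"
      by (rule emeasure_bind[OF not_empty t XR, symmetric])
    finally show "emeasure (distr (M x) ?R (\<theta> x (Suc n))) X
        = emeasure (M x \<bind> (\<lambda>\<omega>. transition (\<theta> x n \<omega>))) X" .
  qed
  then have "(\<integral>\<^sup>+z. g z \<partial>distr (M x) ?R (\<theta> x (Suc n)))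
      = (\<integral>\<^sup>+\<omega>. \<integral>\<^sup>+z. g z \<partial>transition (\<theta> x n \<omega>) \<partial>M x)"
    by (simp add: nn_integral_bind[OF g t])
  also have "\<dots> = expect n (expect 1 g) x"
    unfolding expect_def[of n]
    by (intro nn_integral_cong expect_1[symmetric] g in_domain[OF x])
  finally show ?thesis
    using g by (simp add: expect_def[of "Suc n"] nn_integral_distr[OF measurable_\<theta>[OF x]])
qed

lemma measurable_expect_1:
  assumes g: "g \<in> borel_measurable (restrict_space borel \<Theta>)"
  shows "expect 1 g \<in> borel_measurable (restrict_space borel \<Theta>)"
proof (subst measurable_cong)
  show "expect 1 g y = (\<integral>\<^sup>+z. g z \<partial>transition y)" if "y \<in> space (restrict_space borel \<Theta>)" for y
    using that by (intro expect_1 g) (simp add: space_kernel_domain)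
  show "(\<lambda>y. \<integral>\<^sup>+z. g z \<partial>transition y) \<in> borel_measurable (restrict_space borel \<Theta>)"
    by (rule measurable_compose[OF measurable_transition nn_integral_measurable_subprob_algebra[OF g]])
qed

text \<open>The Markov property as a semigroup law. The induction splits off the last step, moving it
  into the function, so that only the measurability of \<open>expect 1 g\<close> is required.\<close>

theorem expect_add:
  assumes x: "x \<in> \<Theta>" and g: "g \<in> borel_measurable (restrict_space borel \<Theta>)"
  shows "expect (m + n) g x = expect m (expect n g) x"
  using g
proof (induction n arbitrary: g)
  case 0
  show ?case by (simp only: add_0_right) (rule expect_cong[OF x expect_0[symmetric]])
next
  case (Suc n)
  have "expect (m + Suc n) g x = expect (m + n) (expect 1 g) x"
    by (simp only: add_Suc_right expect_Suc[OF x Suc.prems])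
  also have "\<dots> = expect m (expect n (expect 1 g)) x"
    by (rule Suc.IH[OF measurable_expect_1[OF Suc.prems]])
  also have "\<dots> = expect m (expect (Suc n) g) x"
    by (rule expect_cong[OF x]) (rule expect_Suc[OF _ Suc.prems, symmetric])
  finally show ?case .
qed

lemma expect_cmult:
  assumes x: "x \<in> \<Theta>" and g: "g \<in> borel_measurable (restrict_space borel \<Theta>)"
  shows "expect n (\<lambda>y. c * g y) x = c * expect n g x"
  unfolding expect_def
  by (rule nn_integral_cmult) (rule measurable_compose[OF measurable_\<theta>[OF x] g])

text \<open>A conditional expectation has the same mean as the function itself, so a constant
  almost sure bound passes to the mean.\<close>

lemma expect_le_of_nn_cond_exp_le:
  assumes x: "x \<in> \<Theta>" and g: "g \<in> borel_measurable (restrict_space borel \<Theta>)"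
    and le: "AE \<omega> in M x.
      nn_cond_exp (M x) (natural_filtration (M x) (\<theta> x) k) (\<lambda>\<omega>. g (\<theta> x n \<omega>)) \<omega> \<le> c"
  shows "expect n g x \<le> c"
proof -
  interpret prob_space "M x" by (rule prob_space_M[OF x])
  interpret S: sigma_finite_subalgebra "M x" "natural_filtration (M x) (\<theta> x) k"
    by (rule sigma_finite_subalgebra_natural_filtration) (rule measurable_\<theta>_borel[OF x])
  have "expect n g x
      = (\<integral>\<^sup>+\<omega>. nn_cond_exp (M x) (natural_filtration (M x) (\<theta> x) k) (\<lambda>\<omega>. g (\<theta> x n \<omega>)) \<omega> \<partial>M x)"
    unfolding expect_def
    by (rule S.nn_integral_nn_cond_exp[symmetric]) (rule measurable_compose[OF measurable_\<theta>[OF x] g])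
  also have "\<dots> \<le> (\<integral>\<^sup>+\<omega>. c \<partial>M x)"
    using le by (rule nn_integral_mono_AE)
  finally show ?thesis by (simp add: emeasure_space_1)
qed

end

section \<open>Geometric decay of sequences\<close>

text \<open>Going back \<open>N\<close> steps at a time from \<open>n\<close> ends in the first block. There \<open>root N q ^ r \<ge> q\<close>,
  and the division of \<open>b\<close> by \<open>q\<close> compensates exactly for this.\<close>

lemma geometric_decay_of_block_contraction:
  fixes a :: "nat \<Rightarrow> ennreal" and b q :: real
  assumes N: "N \<ge> 1" and q: "0 < q" "q < 1" and b: "b \<ge> 0"
    and contract: "\<And>m. a (m + N) \<le> ennreal q * a m"
    and initial: "\<And>r. r < N \<Longrightarrow> a r \<le> ennreal b"
  shows "a n \<le> ennreal (root N q ^ n * (b / q))"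
proof (induction n rule: less_induct)
  case (less n)
  let ?\<gamma> = "root N q"
  have \<gamma>: "?\<gamma> ^ N = q" "0 < ?\<gamma>" "?\<gamma> < 1"
    using N q by (simp_all add: real_root_pow_pos2)
  show ?case
  proof (cases "n < N")
    case True
    have "q \<le> ?\<gamma> ^ n"
      using \<gamma> True power_decreasing[of n N ?\<gamma>] by simp
    then have "q * (b / q) \<le> ?\<gamma> ^ n * (b / q)"
      using b q by (intro mult_right_mono) auto
    then have "b \<le> ?\<gamma> ^ n * (b / q)" using q by simp
    then show ?thesis
      using initial[OF True] by (meson ennreal_leI order_trans)
  next
    case False
    then have n: "n = (n - N) + N" by simp
    have "a n \<le> ennreal q * a (n - N)" by (subst n) (rule contract)
    also have "\<dots> \<le> ennreal q * ennreal (?\<gamma> ^ (n - N) * (b / q))"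
      using False N by (intro mult_left_mono less.IH) auto
    also have "\<dots> = ennreal (?\<gamma> ^ N * (?\<gamma> ^ (n - N) * (b / q)))"
      using q by (simp add: ennreal_mult'[symmetric] \<gamma>)
    also have "?\<gamma> ^ N * (?\<gamma> ^ (n - N) * (b / q)) = ?\<gamma> ^ n * (b / q)"
      using power_add[of ?\<gamma> N "n - N"] n by (simp add: mult.assoc)
    finally show ?thesis .
  qed
qed

text \<open>After taking logarithms the constant contributes its logarithm divided by \<open>n\<close>, which vanishes in the limit.\<close>

lemma limsup_growth_rate_le:
  fixes a :: "nat \<Rightarrow> ennreal" and \<gamma> c :: real
  assumes \<gamma>: "\<gamma> > 0" and c: "c \<ge> 0"
    and le: "\<And>n. n \<ge> 1 \<Longrightarrow> a n \<le> ennreal (\<gamma> ^ n * c)"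
  shows "limsup (\<lambda>n. ereal (1 / real n) * ln_ext (a n)) \<le> ereal (ln \<gamma>)"
proof -
  \<comment> \<open>Enlarging the constant makes its logarithm finite when \<open>c = 0\<close>.\<close>
  define d where "d = c + 1"
  have d: "d > 0" using c by (simp add: d_def)
  have bound: "ereal (1 / real n) * ln_ext (a n) \<le> ereal (ln \<gamma> + ln d / real n)" if n: "n \<ge> 1" for n
  proof (cases "a n = 0")
    case True
    then show ?thesis using n by (simp add: ln_ext_def)
  next
    case False
    have fin: "a n < \<infinity>" using le[OF n] by (metis ennreal_less_top infinity_ennreal_def order_le_less_trans)
    define r where "r = enn2real (a n)"
    have ar: "a n = ennreal r" using fin by (simp add: r_def less_top)
    have r: "r > 0" using False ar by (metis ennreal_neg not_less)
    have "r \<le> \<gamma> ^ n * c"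
      using le[OF n] \<gamma> c by (simp add: ar ennreal_le_iff)
    also have "\<dots> \<le> \<gamma> ^ n * d" using \<gamma> by (simp add: d_def)
    finally have "ln r \<le> ln (\<gamma> ^ n * d)" using r by simp
    also have "\<dots> = real n * ln \<gamma> + ln d" using \<gamma> d by (simp add: ln_mult ln_realpow)
    finally have "1 / real n * ln r \<le> 1 / real n * (real n * ln \<gamma> + ln d)"
      by (intro mult_left_mono) auto
    also have "\<dots> = ln \<gamma> + ln d / real n" using n by (simp add: field_simps)
    finally show ?thesis
      using False fin by (simp add: ln_ext_def r_def less_top)
  qed
  have "limsup (\<lambda>n. ereal (1 / real n) * ln_ext (a n)) \<le> limsup (\<lambda>n. ereal (ln \<gamma> + ln d / real n))"
    by (rule Limsup_mono) (auto intro!: eventually_sequentiallyI[of 1] bound)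
  also have "\<dots> = ereal (ln \<gamma>)"
  proof (rule lim_imp_Limsup)
    have "(\<lambda>n. ln \<gamma> + ln d / real n) \<longlonglongrightarrow> ln \<gamma> + 0"
      by (intro tendsto_intros lim_const_over_n)
    then show "(\<lambda>n. ereal (ln \<gamma> + ln d / real n)) \<longlonglongrightarrow> ereal (ln \<gamma>)" by simp
  qed simp
  finally show ?thesis .
qed

section \<open>Exponential decay of the Lyapunov function\<close>

theorem theorem4:
  fixes \<Theta> :: "(real ^ 'd) set"
    and \<alpha>\<^sub>0 :: real
    and M :: "real \<Rightarrow> real ^ 'd \<Rightarrow> 'w measure"
    and K :: "real \<Rightarrow> real ^ 'd \<Rightarrow> (real ^ 'd) measure"
    and \<theta> Fn :: "real \<Rightarrow> real ^ 'd \<Rightarrow> nat \<Rightarrow> 'w \<Rightarrow> real ^ 'd"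
    and F :: "real ^ 'd \<Rightarrow> real ^ 'd"
    and \<phi> :: "real \<Rightarrow> real ^ 'd \<Rightarrow> real ^ 'd"
    and \<Psi> :: "real ^ 'd \<Rightarrow> real"
    and \<Delta>\<^sub>1 :: "real \<Rightarrow> real"
    and \<Delta>\<^sub>2 :: "real \<Rightarrow> real \<Rightarrow> real"
  assumes step_range: "\<alpha>\<^sub>0 > 0"
    and kernel: "\<And>\<alpha>. \<alpha> \<in> {0<..\<alpha>\<^sub>0} \<Longrightarrow> K \<alpha> \<in> restrict_space borel \<Theta> \<rightarrow>\<^sub>M prob_algebra borel"
    and algorithm: "\<And>\<alpha> x. \<alpha> \<in> {0<..\<alpha>\<^sub>0} \<Longrightarrow> x \<in> \<Theta> \<Longrightarrow>
          stochastic_algorithm (M \<alpha> x) \<Theta> (K \<alpha>) \<alpha> x (\<theta> \<alpha> x) (Fn \<alpha> x)"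
    and mean_field: "\<And>\<alpha> x. \<alpha> \<in> {0<..\<alpha>\<^sub>0} \<Longrightarrow> x \<in> \<Theta> \<Longrightarrow>
          integrable (K \<alpha> x) (\<lambda>y. y) \<and> F x = (\<integral>y. y \<partial>K \<alpha> x)"
    and flow: "ode_flow \<Theta> F \<phi>"
    and \<Psi>_measurable: "\<Psi> \<in> borel_measurable (restrict_space borel \<Theta>)"
    and \<Psi>_nonneg: "\<And>x. x \<in> \<Theta> \<Longrightarrow> \<Psi> x \<ge> 0"
    and \<Delta>\<^sub>1_nonneg: "\<And>t. t \<ge> 0 \<Longrightarrow> \<Delta>\<^sub>1 t \<ge> 0"
    and \<Delta>\<^sub>1_antimono: "antimono_on {0..} \<Delta>\<^sub>1"
    and \<Delta>\<^sub>1_lim: "(\<Delta>\<^sub>1 \<longlongrightarrow> 0) at_top"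
    and A1: "\<And>x t. x \<in> \<Theta> \<Longrightarrow> t \<ge> 0 \<Longrightarrow> \<Psi> (\<phi> t x) \<le> \<Delta>\<^sub>1 t * \<Psi> x"
    and \<Delta>\<^sub>2_pos: "\<And>\<alpha> T. \<alpha> > 0 \<Longrightarrow> T > 0 \<Longrightarrow> \<Delta>\<^sub>2 \<alpha> T > 0"
    and \<Delta>\<^sub>2_mono1: "\<And>T. T > 0 \<Longrightarrow> mono_on {0<..} (\<lambda>\<alpha>. \<Delta>\<^sub>2 \<alpha> T)"
    and \<Delta>\<^sub>2_mono2: "\<And>\<alpha>. \<alpha> > 0 \<Longrightarrow> mono_on {0<..} (\<lambda>T. \<Delta>\<^sub>2 \<alpha> T)"
    and \<Delta>\<^sub>2_lim: "\<And>T. T > 0 \<Longrightarrow> ((\<lambda>\<alpha>. \<Delta>\<^sub>2 \<alpha> T) \<longlongrightarrow> 0) (at_right 0)"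
    and A2: "\<And>\<alpha> N x. \<alpha> \<in> {0<..\<alpha>\<^sub>0} \<Longrightarrow> N \<ge> 1 \<Longrightarrow> x \<in> \<Theta> \<Longrightarrow>
          AE \<omega> in M \<alpha> x.
            nn_cond_exp (M \<alpha> x) (natural_filtration (M \<alpha> x) (\<theta> \<alpha> x) 0)
              (\<lambda>\<omega>. ennreal (\<Psi> (\<theta> \<alpha> x N \<omega>))) \<omega>
            \<le> ennreal (\<Psi> (\<phi> (real N * \<alpha>) x) + \<Delta>\<^sub>2 \<alpha> (real N * \<alpha>) * \<Psi> x)"
  shows "\<exists>\<alpha>'\<in>{0<..\<alpha>\<^sub>0}. \<forall>\<alpha>\<in>{0<..\<alpha>'}. \<exists>\<gamma>\<in>{0<..<1}. \<exists>C>0.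
           (\<forall>x\<in>\<Theta>. \<forall>n\<ge>1.
              (\<integral>\<^sup>+\<omega>. ennreal (\<Psi> (\<theta> \<alpha> x n \<omega>)) \<partial>M \<alpha> x) \<le> ennreal (\<gamma> ^ n * C * \<Psi> x)) \<and>
           (\<forall>x\<in>\<Theta>.
              limsup (\<lambda>n. ereal (1 / real n) *
                ln_ext (\<integral>\<^sup>+\<omega>. ennreal (\<Psi> (\<theta> \<alpha> x n \<omega>)) \<partial>M \<alpha> x)) \<le> ereal (ln \<gamma>))"
proof -
  have "\<forall>\<^sub>F t in at_top. \<Delta>\<^sub>1 t < 1 / 4"
    using \<Delta>\<^sub>1_lim by (rule order_tendstoD) simp
  then obtain T\<^sub>0 where T\<^sub>0: "\<And>t. t \<ge> T\<^sub>0 \<Longrightarrow> \<Delta>\<^sub>1 t < 1 / 4"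
    by (auto simp: eventually_at_top_linorder)
  \<comment> \<open>The bound on \<open>\<Delta>\<^sub>2\<close> concerns positive times only.\<close>
  define T where "T = max T\<^sub>0 1"
  have T: "T \<ge> 1" "\<And>t. t \<ge> T \<Longrightarrow> \<Delta>\<^sub>1 t < 1 / 4"
    using T\<^sub>0 by (auto simp: T_def)
  have "\<forall>\<^sub>F a in at_right 0. \<Delta>\<^sub>2 a (T + 1) < 1 / 4"
    using T by (intro order_tendstoD[OF \<Delta>\<^sub>2_lim]) auto
  then obtain \<delta> where \<delta>: "\<delta> > 0" "\<And>a. 0 < a \<Longrightarrow> a < \<delta> \<Longrightarrow> \<Delta>\<^sub>2 a (T + 1) < 1 / 4"
    by (auto simp: eventually_at_right_field)
  define \<alpha>' where "\<alpha>' = min \<alpha>\<^sub>0 (min 1 (\<delta> / 2))"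
  have \<alpha>': "\<alpha>' \<in> {0<..\<alpha>\<^sub>0}" using step_range \<delta> by (simp add: \<alpha>'_def)
  show ?thesis
  proof (rule bexI[OF _ \<alpha>'], rule ballI)
    fix \<alpha> assume "\<alpha> \<in> {0<..\<alpha>'}"
    then have \<alpha>: "0 < \<alpha>" "\<alpha> \<le> 1" "\<alpha> \<in> {0<..\<alpha>\<^sub>0}" and \<Delta>\<^sub>2_small: "\<Delta>\<^sub>2 \<alpha> (T + 1) < 1 / 4"
      using \<delta> by (auto simp: \<alpha>'_def)
    interpret markov_algorithm \<Theta> "K \<alpha>" \<alpha> "M \<alpha>" "\<theta> \<alpha>" "Fn \<alpha>"
      using kernel[OF \<alpha>(3)] algorithm[OF \<alpha>(3)] by unfold_locales
    let ?V = "\<lambda>x. ennreal (\<Psi> x)"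
    have V: "?V \<in> borel_measurable (restrict_space borel \<Theta>)"
      using \<Psi>_measurable by measurable
    have bound: "expect N ?V x \<le> ennreal ((\<Delta>\<^sub>1 (real N * \<alpha>) + \<Delta>\<^sub>2 \<alpha> (T + 1)) * \<Psi> x)"
      if N: "N \<ge> 1" "real N * \<alpha> \<le> T + 1" and x: "x \<in> \<Theta>" for N x
    proof -
      have pos: "real N * \<alpha> > 0" using N \<alpha> by simp
      have "expect N ?V x \<le> ennreal (\<Psi> (\<phi> (real N * \<alpha>) x) + \<Delta>\<^sub>2 \<alpha> (real N * \<alpha>) * \<Psi> x)"
        by (rule expect_le_of_nn_cond_exp_le[OF x V A2[OF \<alpha>(3) N(1) x]])
      also have "\<dots> \<le> ennreal ((\<Delta>\<^sub>1 (real N * \<alpha>) + \<Delta>\<^sub>2 \<alpha> (T + 1)) * \<Psi> x)"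
      proof (rule ennreal_leI)
        have "\<Delta>\<^sub>2 \<alpha> (real N * \<alpha>) \<le> \<Delta>\<^sub>2 \<alpha> (T + 1)"
          using pos N T by (intro mono_onD[OF \<Delta>\<^sub>2_mono2[OF \<alpha>(1)]]) auto
        then have "\<Delta>\<^sub>2 \<alpha> (real N * \<alpha>) * \<Psi> x \<le> \<Delta>\<^sub>2 \<alpha> (T + 1) * \<Psi> x"
          using \<Psi>_nonneg[OF x] by (rule mult_right_mono)
        then show "\<Psi> (\<phi> (real N * \<alpha>) x) + \<Delta>\<^sub>2 \<alpha> (real N * \<alpha>) * \<Psi> x
            \<le> (\<Delta>\<^sub>1 (real N * \<alpha>) + \<Delta>\<^sub>2 \<alpha> (T + 1)) * \<Psi> x"
          using A1[OF x, of "real N * \<alpha>"] pos by (simp add: distrib_right)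
      qed
      finally show ?thesis .
    qed
    \<comment> \<open>The least number of steps of total duration at least \<open>T\<close>.\<close>
    define N where "N = nat \<lceil>T / \<alpha>\<rceil>"
    have "T / \<alpha> > 0" using T \<alpha> by simp
    then have N: "N \<ge> 1" "T / \<alpha> \<le> real N" "real N < T / \<alpha> + 1"
      unfolding N_def by linarith+
    then have N\<alpha>: "T \<le> real N * \<alpha>" "real N * \<alpha> \<le> T + 1"
      using \<alpha> by (auto simp: field_simps)
    have block: "expect N ?V x \<le> ennreal (1 / 2) * ?V x" if x: "x \<in> \<Theta>" for x
    proof -
      have "\<Delta>\<^sub>1 (real N * \<alpha>) + \<Delta>\<^sub>2 \<alpha> (T + 1) \<le> 1 / 2"
        using T(2)[OF N\<alpha>(1)] \<Delta>\<^sub>2_small by linarith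
      then have "ennreal ((\<Delta>\<^sub>1 (real N * \<alpha>) + \<Delta>\<^sub>2 \<alpha> (T + 1)) * \<Psi> x) \<le> ennreal (1 / 2 * \<Psi> x)"
        using \<Psi>_nonneg[OF x] by (intro ennreal_leI mult_right_mono)
      then show ?thesis
        using bound[OF N(1) N\<alpha>(2) x] by (simp only: ennreal_mult'[symmetric])
    qed
    have contract: "expect (m + N) ?V x \<le> ennreal (1 / 2) * expect m ?V x" if x: "x \<in> \<Theta>" for m x
    proof -
      have "expect m (expect N ?V) x \<le> expect m (\<lambda>y. ennreal (1 / 2) * ?V y) x"
        by (rule expect_mono[OF x block])
      then show ?thesis
        by (simp only: expect_add[OF x V] expect_cmult[OF x V])
    qed
    \<comment> \<open>Before a block is complete, only the factor \<open>\<Delta>\<^sub>1 0\<close> controls the flow; the summand \<open>1\<close> absorbs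
      the error term and also makes \<open>B \<ge> 1\<close>, as the time \<open>0\<close> requires.\<close>
    define B where "B = \<Delta>\<^sub>1 0 + 1"
    have B: "B \<ge> 1" using \<Delta>\<^sub>1_nonneg[of 0] by (simp add: B_def)
    have initial: "expect r ?V x \<le> ennreal (B * \<Psi> x)" if r: "r < N" and x: "x \<in> \<Theta>" for r x
    proof (cases "r = 0")
      case True
      have "1 * \<Psi> x \<le> B * \<Psi> x" using B \<Psi>_nonneg[OF x] by (rule mult_right_mono)
      then show ?thesis by (simp add: True expect_0[OF x] ennreal_leI)
    next
      case False
      have r\<alpha>: "real r * \<alpha> \<le> T + 1"
        using r \<alpha> N\<alpha>(2) by (meson less_imp_le mult_right_mono of_nat_mono order_trans)
      have "\<Delta>\<^sub>1 (real r * \<alpha>) \<le> \<Delta>\<^sub>1 0"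
        using \<alpha> by (intro monotone_onD[OF \<Delta>\<^sub>1_antimono]) auto
      then have "\<Delta>\<^sub>1 (real r * \<alpha>) + \<Delta>\<^sub>2 \<alpha> (T + 1) \<le> B"
        using \<Delta>\<^sub>2_small by (simp add: B_def)
      then have "ennreal ((\<Delta>\<^sub>1 (real r * \<alpha>) + \<Delta>\<^sub>2 \<alpha> (T + 1)) * \<Psi> x) \<le> ennreal (B * \<Psi> x)"
        using \<Psi>_nonneg[OF x] by (intro ennreal_leI mult_right_mono)
      then show ?thesis
        using bound[of r x] False r\<alpha> x by (meson less_one not_less order_trans)
    qed
    define \<gamma> where "\<gamma> = root N (1 / 2)"
    have \<gamma>: "\<gamma> \<in> {0<..<1}" using N(1) by (simp add: \<gamma>_def)
    define C where "C = B / (1 / 2)"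
    have C: "C > 0" using B by (simp add: C_def)
    have decay: "expect n ?V x \<le> ennreal (\<gamma> ^ n * (C * \<Psi> x))" if x: "x \<in> \<Theta>" for x n
      using geometric_decay_of_block_contraction[of N "1/2" "B * \<Psi> x" "\<lambda>n. expect n ?V x" n]
        N(1) contract[OF x] initial[OF _ x] B \<Psi>_nonneg[OF x]
      by (simp add: \<gamma>_def C_def mult_ac)
    have rate: "limsup (\<lambda>n. ereal (1 / real n) * ln_ext (expect n ?V x)) \<le> ereal (ln \<gamma>)"
      if x: "x \<in> \<Theta>" for x
      using \<gamma> C \<Psi>_nonneg[OF x] decay[OF x]
      by (intro limsup_growth_rate_le[where c = "C * \<Psi> x"]) auto
    show "\<exists>\<gamma>\<in>{0<..<1}. \<exists>C>0.
           (\<forall>x\<in>\<Theta>. \<forall>n\<ge>1.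
              (\<integral>\<^sup>+\<omega>. ennreal (\<Psi> (\<theta> \<alpha> x n \<omega>)) \<partial>M \<alpha> x) \<le> ennreal (\<gamma> ^ n * C * \<Psi> x)) \<and>
           (\<forall>x\<in>\<Theta>.
              limsup (\<lambda>n. ereal (1 / real n) *
                ln_ext (\<integral>\<^sup>+\<omega>. ennreal (\<Psi> (\<theta> \<alpha> x n \<omega>)) \<partial>M \<alpha> x)) \<le> ereal (ln \<gamma>))"
      using \<gamma> C decay rate unfolding expect_def
      by (intro bexI[of _ \<gamma>] exI[of _ C]) (auto simp: mult.assoc)
  qed
qed

end
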